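(* Let $(X,d_X,\leq_{P_1})$ and $(Y,d_Y,\leq_{P_2})$ be two partially ordered complete metric spaces. Let $F:X\times Y\rightarrow X$ and $G:Y\times X\rightarrow Y$ be two continuous functions having the mixed monotone property. Assume that there exist $k,l,m,n\in \left[0,\frac{1}{2}\right)$ satisfying $$d_X(F(x,y),F(u,v))\leq k\, d_X(x,F(u,v))+l\, d_X(u, F(x,y))\quad \text{for all } x,u\in X,\ y,v\in Y \text{ with } x\geq_{P_1}u,\ y\leq_{P_2}v,$$ $$d_Y(G(y,x),G(v,u))\leq m\, d_Y(y,G(v,u))+n\, d_Y(v,G(y,x))\quad \text{for all } x,u\in X,\ y,v\in Y \text{ with } x\leq_{P_1}u,\ y\geq_{P_2}v.$$ If there exist $x_0\in X$, $y_0\in Y$ satisfying $x_0\leq_{P_1} F(x_0, y_0)$ and $y_0\geq_{P_2} G(y_0, x_0)$, then there exist $x\in X$, $y\in Y$ such that $x=F(x,y)$ and $y=G(y,x)$.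
   Context: A partially ordered complete metric space $(X,d_X,\leq_{P_1})$ is a set $X$ with a metric $d_X$ for which it is complete and a partial order $\leq_{P_1}$ (no compatibility between them is assumed). The product $X\times Y$ carries the metric $d((x,y),(u,v))=d_X(x,u)+d_Y(y,v)$ (similarly for $Y\times X$). The maps $F:X\times Y\to X$ and $G:Y\times X\to Y$ have the mixed monotone property if for all $x\in X$, $y\in Y$: for all $x_1,x_2\in X$, $x_1\leq_{P_1} x_2$ implies $F(x_1,y)\leq_{P_1} F(x_2,y)$ and $G(y,x_1)\geq_{P_2}G(y,x_2)$; and for all $y_1,y_2\in Y$, $y_1\leq_{P_2}y_2$ implies $F(x,y_1)\geq_{P_1}F(x,y_2)$ and $G(y_1,x)\leq_{P_2}G(y_2,x)$. *)

theory Defs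
  imports "HOL-Analysis.Analysis"
begin

text \<open>Orders are relations: \<open>(a, b) \<in> P\<close> reads \<open>a \<le> b\<close>. The metric and the order are attached
  to a carrier set, not taken from type classes, so that \<open>X\<close> and \<open>Y\<close> may live in the same type
  with different metrics and orders.\<close>

definition po_complete_metric_space ::
    "'a set \<Rightarrow> ('a \<Rightarrow> 'a \<Rightarrow> real) \<Rightarrow> 'a rel \<Rightarrow> bool" where
  "po_complete_metric_space X d P \<longleftrightarrow>
     Metric_space X d \<and> Metric_space.mcomplete X d \<and> partial_order_on X P"

definition sum_dist ::
    "('a \<Rightarrow> 'a \<Rightarrow> real) \<Rightarrow> ('b \<Rightarrow> 'b \<Rightarrow> real) \<Rightarrow> 'a \<times> 'b \<Rightarrow> 'a \<times> 'b \<Rightarrow> real" where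
  "sum_dist dX dY p q = dX (fst p) (fst q) + dY (snd p) (snd q)"

text \<open>The topology \<open>Metric_space.mtopology\<close> of the product, used in the statement, is
  meaningful because the sum distance is a metric.\<close>

lemma Metric_space_sum_dist:
  assumes "Metric_space X dX" "Metric_space Y dY"
  shows "Metric_space (X \<times> Y) (sum_dist dX dY)"
proof -
  interpret X: Metric_space X dX by fact
  interpret Y: Metric_space Y dY by fact
  show ?thesis
  proof
    show "0 \<le> sum_dist dX dY p q" for p q
      by (simp add: sum_dist_def)
    show "sum_dist dX dY p q = sum_dist dX dY q p" for p q
      by (simp add: sum_dist_def X.commute Y.commute)
    show "(sum_dist dX dY p q = 0) = (p = q)" if "p \<in> X \<times> Y" "q \<in> X \<times> Y" for p q
      using that by (auto simp: sum_dist_def add_nonneg_eq_0_iff prod_eq_iff)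
    show "sum_dist dX dY p r \<le> sum_dist dX dY p q + sum_dist dX dY q r"
      if "p \<in> X \<times> Y" "q \<in> X \<times> Y" "r \<in> X \<times> Y" for p q r
      using that X.triangle[of "fst p" "fst q" "fst r"] Y.triangle[of "snd p" "snd q" "snd r"]
      by (auto simp: sum_dist_def)
  qed
qed

definition mixed_monotone ::
    "'a set \<Rightarrow> 'a rel \<Rightarrow> 'b set \<Rightarrow> 'b rel \<Rightarrow> ('a \<times> 'b \<Rightarrow> 'a) \<Rightarrow> ('b \<times> 'a \<Rightarrow> 'b) \<Rightarrow> bool" where
  "mixed_monotone X P1 Y P2 F G \<longleftrightarrow>
     (\<forall>x\<in>X. \<forall>y\<in>Y.
        (\<forall>x1\<in>X. \<forall>x2\<in>X. (x1, x2) \<in> P1 \<longrightarrow>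
            (F (x1, y), F (x2, y)) \<in> P1 \<and> (G (y, x2), G (y, x1)) \<in> P2) \<and>
        (\<forall>y1\<in>Y. \<forall>y2\<in>Y. (y1, y2) \<in> P2 \<longrightarrow>
            (F (x, y2), F (x, y1)) \<in> P1 \<and> (G (y1, x), G (y2, x)) \<in> P2))"

end

theory Submission
  imports Defs
begin

text \<open>The iterates \<open>x\<^sub>i\<^sub>+\<^sub>1 = F (x\<^sub>i, y\<^sub>i)\<close>, \<open>y\<^sub>i\<^sub>+\<^sub>1 = G (y\<^sub>i, x\<^sub>i)\<close> are monotone in opposite directions,
  so the contraction hypotheses apply to consecutive iterates. One of the two terms on the right
  then vanishes, which leaves \<open>d (x\<^sub>i\<^sub>+\<^sub>1, x\<^sub>i\<^sub>+\<^sub>2) \<le> l d (x\<^sub>i, x\<^sub>i\<^sub>+\<^sub>2)\<close>; by the triangle inequality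
  consecutive distances shrink by the factor \<open>l / (1 - l) < 1\<close>. The same holds for \<open>y\<close> with \<open>m\<close> in
  place of \<open>l\<close>. Both sequences therefore converge, and continuity turns the limits into a coupled
  fixed point.\<close>

text \<open>The \<open>i\<close>-th step has length at most \<open>D * q ^ i\<close>, where
  \<open>D\<close> is the length of the first step, so the tails are dominated by those of a
  convergent geometric series.\<close>

lemma (in Metric_space) MCauchy_if_geometric_steps:
  assumes M: "range s \<subseteq> M" and q: "0 \<le> q" "q < 1"
    and step: "\<And>i. d (s (Suc i)) (s (Suc (Suc i))) \<le> q * d (s i) (s (Suc i))"
  shows "MCauchy s"
proof -
  define D where "D = d (s 0) (s (Suc 0))"
  have D: "0 \<le> D" by (simp add: D_def)
  have sM: "s i \<in> M" for i using M by auto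
  have geo: "d (s i) (s (Suc i)) \<le> D * q ^ i" for i
  proof (induction i)
    case (Suc i)
    have "d (s (Suc i)) (s (Suc (Suc i))) \<le> q * d (s i) (s (Suc i))" by (rule step)
    also have "\<dots> \<le> q * (D * q ^ i)" using Suc q by (intro mult_left_mono)
    finally show ?case by (simp add: mult_ac)
  qed (simp add: D_def)
  \<comment> \<open>This is the finite geometric sum in closed form, multiplied through by
    \<open>1 - q\<close> so that the induction needs neither sums nor division.\<close>
  have tail_sum: "(1 - q) * d (s i) (s (i + p)) \<le> D * q ^ i * (1 - q ^ p)" for i p
  proof (induction p)
    case (Suc p)
    have "(1 - q) * d (s i) (s (i + Suc p))
        \<le> (1 - q) * (d (s i) (s (i + p)) + d (s (i + p)) (s (Suc (i + p))))"
      using q triangle[OF sM[of i] sM[of "i + p"] sM[of "Suc (i + p)"]] by (intro mult_left_mono) auto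
    also have "\<dots> \<le> D * q ^ i * (1 - q ^ p) + (1 - q) * (D * q ^ (i + p))"
      unfolding distrib_left using Suc geo q by (intro add_mono mult_left_mono) auto
    also have "\<dots> = D * q ^ i * (1 - q ^ Suc p)" by (simp add: algebra_simps power_add)
    finally show ?case .
  qed (simp add: sM)
  \<comment> \<open>Bounding \<open>1 - q ^ (j - i)\<close> by 1 makes the estimate independent of
    \<open>j\<close>; it tends to 0 with growing \<open>i\<close>.\<close>
  have tail: "d (s i) (s j) \<le> D * q ^ i / (1 - q)" if "i \<le> j" for i j
  proof -
    have "(1 - q) * d (s i) (s j) \<le> D * q ^ i * (1 - q ^ (j - i))"
      using tail_sum[of i "j - i"] that by simp
    also have "\<dots> \<le> D * q ^ i" using D q by (intro mult_left_le) auto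
    finally show ?thesis using q by (simp add: pos_le_divide_eq mult.commute)
  qed
  have "\<exists>N. \<forall>i j. N \<le> i \<longrightarrow> N \<le> j \<longrightarrow> d (s i) (s j) < e" if "0 < e" for e
  proof -
    have "(\<lambda>i. D * q ^ i / (1 - q)) \<longlonglongrightarrow> D * 0 / (1 - q)"
      using q by (intro tendsto_intros LIMSEQ_realpow_zero) auto
    then have "\<forall>\<^sub>F i in sequentially. D * q ^ i / (1 - q) < e"
      using order_tendstoD(2) that by fastforce
    then obtain N where N: "\<And>i. N \<le> i \<Longrightarrow> D * q ^ i / (1 - q) < e"
      by (auto simp: eventually_sequentially)
    have "d (s i) (s j) < e" if "N \<le> i" "N \<le> j" for i j
    proof (cases "i \<le> j")
      case True
      then show ?thesis using tail N that by (meson le_less_trans)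
    next
      case False
      then have "d (s j) (s i) < e" using tail[of j i] N[of j] that by linarith
      then show ?thesis by (simp add: commute)
    qed
    then show ?thesis by blast
  qed
  with M show ?thesis by (auto simp: MCauchy_def)
qed

text \<open>Splitting the two-step distance at \<open>s (Suc i)\<close> and absorbing one part on
  the left gives the ratio \<open>c / (1 - c)\<close>, which is below 1 exactly because
  \<open>c < 1/2\<close>.\<close>

lemma (in Metric_space) MCauchy_if_two_step_bound:
  assumes M: "range s \<subseteq> M" and c: "0 \<le> c" "c < 1/2"
    and step: "\<And>i. d (s (Suc i)) (s (Suc (Suc i))) \<le> c * d (s i) (s (Suc (Suc i)))"
  shows "MCauchy s"
proof (rule MCauchy_if_geometric_steps[OF M])
  show "0 \<le> c / (1 - c)" "c / (1 - c) < 1" using c by (auto simp: field_simps)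
  fix i
  have "s j \<in> M" for j using M by auto
  then have "d (s i) (s (Suc (Suc i))) \<le> d (s i) (s (Suc i)) + d (s (Suc i)) (s (Suc (Suc i)))"
    by (intro triangle)
  then have "c * d (s i) (s (Suc (Suc i)))
      \<le> c * (d (s i) (s (Suc i)) + d (s (Suc i)) (s (Suc (Suc i))))"
    using c by (intro mult_left_mono) auto
  with step[of i] have "(1 - c) * d (s (Suc i)) (s (Suc (Suc i))) \<le> c * d (s i) (s (Suc i))"
    by (simp add: algebra_simps)
  then show "d (s (Suc i)) (s (Suc (Suc i))) \<le> c / (1 - c) * d (s i) (s (Suc i))"
    using c by (simp add: field_simps)
qed

lemma limitin_sum_dist:
  assumes X: "Metric_space X dX" and Y: "Metric_space Y dY"
    and s: "limitin (Metric_space.mtopology X dX) s a H"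
    and t: "limitin (Metric_space.mtopology Y dY) t b H"
  shows "limitin (Metric_space.mtopology (X \<times> Y) (sum_dist dX dY)) (\<lambda>i. (s i, t i)) (a, b) H"
proof -
  interpret X: Metric_space X dX by (rule X)
  interpret Y: Metric_space Y dY by (rule Y)
  interpret XY: Metric_space "X \<times> Y" "sum_dist dX dY" by (rule Metric_space_sum_dist[OF X Y])
  show ?thesis
    using s t unfolding X.limitin_metric_dist_null Y.limitin_metric_dist_null
      XY.limitin_metric_dist_null
    by (auto simp: sum_dist_def eventually_conj_iff intro: tendsto_add_zero)
qed

text \<open>By continuity \<open>F (s i, t i)\<close> tends to \<open>F (a, b)\<close>; but this is
  \<open>s\<close> shifted by one, which still tends to \<open>a\<close>, and limits in a metric
  space are unique.\<close>

lemma limit_of_iterates_eq: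
  assumes X: "Metric_space X dX" and Y: "Metric_space Y dY"
    and F: "continuous_map (Metric_space.mtopology (X \<times> Y) (sum_dist dX dY))
              (Metric_space.mtopology X dX) F"
    and s: "limitin (Metric_space.mtopology X dX) s a sequentially"
    and t: "limitin (Metric_space.mtopology Y dY) t b sequentially"
    and rec: "\<And>i. s (Suc i) = F (s i, t i)"
  shows "a = F (a, b)"
proof -
  interpret X: Metric_space X dX by (rule X)
  have "limitin X.mtopology (F \<circ> (\<lambda>i. (s i, t i))) (F (a, b)) sequentially"
    by (rule continuous_map_limit[OF F limitin_sum_dist[OF X Y s t]])
  then have "limitin X.mtopology (\<lambda>i. s (i + 1)) (F (a, b)) sequentially"
    by (simp add: rec comp_def)
  with limitin_sequentially_offset[OF s, of 1] show ?thesis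
    by (rule X.limitin_metric_unique) (rule trivial_limit_sequentially)
qed

text \<open>Mixed monotonicity moves one argument at a time, so both chains pass through the
  intermediate pair of \<open>u\<close> and \<open>y\<close>.\<close>

lemma mixed_monotone_le:
  assumes "mixed_monotone X P1 Y P2 F G" "F \<in> X \<times> Y \<rightarrow> X" "G \<in> Y \<times> X \<rightarrow> Y"
    and "trans P1" "trans P2"
    and "x \<in> X" "u \<in> X" "y \<in> Y" "v \<in> Y" "(x, u) \<in> P1" "(v, y) \<in> P2"
  shows "(F (x, y), F (u, v)) \<in> P1" "(G (v, u), G (y, x)) \<in> P2"
proof -
  have "(F (x, y), F (u, y)) \<in> P1" "(F (u, y), F (u, v)) \<in> P1"
    using assms unfolding mixed_monotone_def by blast+
  then show "(F (x, y), F (u, v)) \<in> P1" using \<open>trans P1\<close> by (meson transD)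
  have "(G (v, u), G (y, u)) \<in> P2" "(G (y, u), G (y, x)) \<in> P2"
    using assms unfolding mixed_monotone_def by blast+
  then show "(G (v, u), G (y, x)) \<in> P2" using \<open>trans P2\<close> by (meson transD)
qed

theorem theorem2p6:
  fixes X :: "'a set" and dX :: "'a \<Rightarrow> 'a \<Rightarrow> real" and P1 :: "'a rel"
    and Y :: "'b set" and dY :: "'b \<Rightarrow> 'b \<Rightarrow> real" and P2 :: "'b rel"
    and F :: "'a \<times> 'b \<Rightarrow> 'a" and G :: "'b \<times> 'a \<Rightarrow> 'b"
    and k l m n :: real
  assumes "po_complete_metric_space X dX P1"
    and "po_complete_metric_space Y dY P2"
    and "F \<in> X \<times> Y \<rightarrow> X"
    and "G \<in> Y \<times> X \<rightarrow> Y"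
    and "continuous_map (Metric_space.mtopology (X \<times> Y) (sum_dist dX dY))
           (Metric_space.mtopology X dX) F"
    and "continuous_map (Metric_space.mtopology (Y \<times> X) (sum_dist dY dX))
           (Metric_space.mtopology Y dY) G"
    and "mixed_monotone X P1 Y P2 F G"
    and "k \<in> {0..<1/2}" "l \<in> {0..<1/2}" "m \<in> {0..<1/2}" "n \<in> {0..<1/2}"
    and "\<forall>x\<in>X. \<forall>u\<in>X. \<forall>y\<in>Y. \<forall>v\<in>Y. (u, x) \<in> P1 \<and> (y, v) \<in> P2 \<longrightarrow>
           dX (F (x, y)) (F (u, v)) \<le> k * dX x (F (u, v)) + l * dX u (F (x, y))"
    and "\<forall>x\<in>X. \<forall>u\<in>X. \<forall>y\<in>Y. \<forall>v\<in>Y. (x, u) \<in> P1 \<and> (v, y) \<in> P2 \<longrightarrow>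
           dY (G (y, x)) (G (v, u)) \<le> m * dY y (G (v, u)) + n * dY v (G (y, x))"
    and "\<exists>x0\<in>X. \<exists>y0\<in>Y. (x0, F (x0, y0)) \<in> P1 \<and> (G (y0, x0), y0) \<in> P2"
  shows "\<exists>x\<in>X. \<exists>y\<in>Y. x = F (x, y) \<and> y = G (y, x)"
proof -
  interpret X: Metric_space X dX
    using assms(1) by (simp add: po_complete_metric_space_def)
  interpret Y: Metric_space Y dY
    using assms(2) by (simp add: po_complete_metric_space_def)
  have trans: "trans P1" "trans P2"
    using assms(1,2)
    by (auto simp: po_complete_metric_space_def partial_order_on_def preorder_on_def)
  obtain x0 y0 where init: "x0 \<in> X" "y0 \<in> Y" "(x0, F (x0, y0)) \<in> P1" "(G (y0, x0), y0) \<in> P2"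
    using assms(14) by blast
  \<comment> \<open>The two recursions are coupled, so the pair is iterated and then
    projected.\<close>
  define z where "z = (\<lambda>i. ((\<lambda>(x, y). (F (x, y), G (y, x))) ^^ i) (x0, y0))"
  define s where "s = (\<lambda>i. fst (z i))"
  define t where "t = (\<lambda>i. snd (z i))"
  have zero: "s 0 = x0" "t 0 = y0" by (simp_all add: s_def t_def z_def)
  have sSuc: "s (Suc i) = F (s i, t i)" and tSuc: "t (Suc i) = G (t i, s i)" for i
    by (simp_all add: s_def t_def z_def case_prod_beta)
  have "s i \<in> X \<and> t i \<in> Y" for i
    by (induction i) (use init assms(3,4) in \<open>auto simp: zero sSuc tSuc\<close>)
  then have sX: "s i \<in> X" and tY: "t i \<in> Y" for i by auto
  have mono: "(s i, s (Suc i)) \<in> P1 \<and> (t (Suc i), t i) \<in> P2" for i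
  proof (induction i)
    case 0
    then show ?case using init by (simp add: zero sSuc tSuc)
  next
    case (Suc i)
    then show ?case
      using mixed_monotone_le[OF assms(7,3,4) trans
          sX[of i] sX[of "Suc i"] tY[of i] tY[of "Suc i"]]
      by (simp flip: sSuc tSuc)
  qed
  have "X.MCauchy s"
  proof (rule X.MCauchy_if_two_step_bound)
    \<comment> \<open>The later pair is the one with larger first coordinate, so it takes the place
      of \<open>(x, y)\<close>. The \<open>k\<close> term becomes the distance from
      \<open>s (Suc i)\<close> to itself.\<close>
    show "dX (s (Suc i)) (s (Suc (Suc i))) \<le> l * dX (s i) (s (Suc (Suc i)))" for i
      using assms(12)[rule_format, OF sX[of "Suc i"] sX[of i] tY[of "Suc i"] tY[of i]] mono[of i] sX
      by (simp add: X.commute flip: sSuc)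
  qed (use sX assms(9) in auto)
  then obtain a where a: "limitin X.mtopology s a sequentially"
    using assms(1) by (auto simp: po_complete_metric_space_def X.mcomplete_def)
  have "Y.MCauchy t"
  proof (rule Y.MCauchy_if_two_step_bound)
    \<comment> \<open>Here the order condition is reversed: the earlier pair takes the place of
      \<open>(x, y)\<close>, and it is the \<open>n\<close> term that vanishes.\<close>
    show "dY (t (Suc i)) (t (Suc (Suc i))) \<le> m * dY (t i) (t (Suc (Suc i)))" for i
      using assms(13)[rule_format, OF sX[of i] sX[of "Suc i"] tY[of i] tY[of "Suc i"]] mono[of i] tY
      by (simp flip: tSuc)
  qed (use tY assms(10) in auto)
  then obtain b where b: "limitin Y.mtopology t b sequentially"
    using assms(2) by (auto simp: po_complete_metric_space_def Y.mcomplete_def)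
  have "a = F (a, b)"
    by (rule limit_of_iterates_eq[OF X.Metric_space_axioms Y.Metric_space_axioms assms(5) a b])
      (rule sSuc)
  \<comment> \<open>The same limit argument, with the roles of the two spaces and sequences
    exchanged to match the product \<open>Y \<times> X\<close>.\<close>
  moreover have "b = G (b, a)"
    by (rule limit_of_iterates_eq[OF Y.Metric_space_axioms X.Metric_space_axioms assms(6) b a])
      (rule tSuc)
  moreover have "a \<in> X" "b \<in> Y"
    using a b by (simp_all add: X.limitin_metric Y.limitin_metric)
  ultimately show ?thesis by blast
qed

end
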